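(* For every even integer $t\ge 4$, the following hold. (a) There exist a $t$-cyclic matroid $M$, an even $t$-cyclic ordering $\sigma$ of $E(M)$, and an even concatenation $\Phi=(P_1,P_2,\ldots,P_m)$ of $\sigma$ with $m\ge 4$ such that $\Phi$ is a $(t-1)$-anemone of $M$. (b) There exist a $t$-cyclic matroid $M$, an even $t$-cyclic ordering $\sigma$ of $E(M)$, and an even concatenation $\Phi=(P_1,P_2,\ldots,P_m)$ of $\sigma$ with $m\ge 4$ such that $\Phi$ is a $(t-1)$-daisy of $M$.
   Context: Notation: $[n]=\{1,\ldots,n\}$. For a cyclic ordering $(e_1,\ldots,e_n)$ of $E(M)$, subscripts are interpreted modulo $n$. $t$-cyclic matroids: Let $M$ be a matroid with $n=|E(M)|$ and let $t$ be a positive integer with $n\ge t+1$. $M$ is $t$-cyclic if there is a cyclic ordering $\sigma=(e_1,\ldots,e_n)$ of $E(M)$ such that, for all odd $i\in[n]$, either (i) $\{e_i,\ldots,e_{i+t-1}\}$ is a $t$-element circuit and $\{e_{i+1},\ldots,e_{i+t}\}$ is a $t$-element cocircuit, or (ii) $\{e_i,\ldots,e_{i+t-1}\}$ is both a $t$-element circuit and a $t$-element cocircuit. Such a $\sigma$ is a $t$-cyclic ordering of $M$; it is even if it satisfies (ii) for all odd $i\in[n]$. Concatenation: $(P_1,\ldots,P_m)$ is a concatenation of $\sigma$ if the $P_i$ are non-empty sets of cyclically consecutive elements of $\sigma$ that partition $E(M)$ and occur in this cyclic order. For an even $t$-cyclic ordering $\sigma$, the concatenation is even if, for each $i\in[m]$,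 writing $P_i=\{e_{j+1},e_{j+2},\ldots,e_{j+k}\}$ in the order of $\sigma$ with $e_{j+1}$ the first element of the block, we have $|P_i|\ge t-2$, $|P_i|$ is even, and $j+1$ is odd. Connectivity: for $X\subseteq E(M)$, $\lambda(X)=r(X)+r(E(M)-X)-r(M)$; $X$ is exactly $k$-separating if $\lambda(X)=k-1$. Flowers: For $m>1$, a partition $\Phi=(P_1,\ldots,P_m)$ of $E(M)$ into non-empty sets is a $k$-flower if each $P_i$ is exactly $k$-separating and, when $m\ge 3$, each $P_i\cup P_{i+1}$ is exactly $k$-separating (petal subscripts modulo $m$). A $k$-flower $\Phi$ is a $k$-anemone if $\bigcup_{i\in I}P_i$ is exactly $k$-separating for all non-empty proper subsets $I$ of $[m]$; it is a $k$-daisy if $\bigcup_{i\in I}P_i$ is exactly $k$-separating for precisely those non-empty proper subsets $I$ of $[m]$ whose members form a consecutive set in the cyclic order $(1,\ldots,m)$. *)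

theory Defs
  imports Main
begin

section \<open>Matroids\<close>

record 'a matroid_structure =
  ground :: "'a set"
  indeps :: "'a set set"

locale matroid =
  fixes M :: "'a matroid_structure"
  assumes finite_ground: "finite (ground M)"
    and indeps_subset_ground: "X \<in> indeps M \<Longrightarrow> X \<subseteq> ground M"
    and empty_indep: "{} \<in> indeps M"
    and indep_subset: "\<lbrakk>X \<in> indeps M; Y \<subseteq> X\<rbrakk> \<Longrightarrow> Y \<in> indeps M"
    and augmentation: "\<lbrakk>X \<in> indeps M; Y \<in> indeps M; card X < card Y\<rbrakk>
      \<Longrightarrow> \<exists>y \<in> Y - X. insert y X \<in> indeps M"

definition basis :: "'a matroid_structure \<Rightarrow> 'a set \<Rightarrow> bool" where
  "basis M B \<longleftrightarrow> B \<in> indeps M \<and> (\<forall>X \<in> indeps M. B \<subseteq> X \<longrightarrow> X = B)"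

definition circuit :: "'a matroid_structure \<Rightarrow> 'a set \<Rightarrow> bool" where
  "circuit M C \<longleftrightarrow> C \<subseteq> ground M \<and> C \<notin> indeps M \<and> (\<forall>X. X \<subset> C \<longrightarrow> X \<in> indeps M)"

definition dual :: "'a matroid_structure \<Rightarrow> 'a matroid_structure" where
  "dual M = \<lparr>ground = ground M,
             indeps = {X. \<exists>B. basis M B \<and> X \<subseteq> ground M - B}\<rparr>"

definition cocircuit :: "'a matroid_structure \<Rightarrow> 'a set \<Rightarrow> bool" where
  "cocircuit M C \<longleftrightarrow> circuit (dual M) C"

definition rank :: "'a matroid_structure \<Rightarrow> 'a set \<Rightarrow> nat" where
  "rank M X = Max {card I | I. I \<in> indeps M \<and> I \<subseteq> X}"

definition connectivity :: "'a matroid_structure \<Rightarrow> 'a set \<Rightarrow> int" where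
  "connectivity M X =
     int (rank M X) + int (rank M (ground M - X)) - int (rank M (ground M))"

definition exactly_separating :: "'a matroid_structure \<Rightarrow> nat \<Rightarrow> 'a set \<Rightarrow> bool" where
  "exactly_separating M k X \<longleftrightarrow> connectivity M X = int k - 1"


section \<open>Cyclic orderings and concatenations\<close>

text \<open>A cyclic ordering \<open>(e\<^sub>1, \<dots>, e\<^sub>n)\<close> of \<open>E\<close> is the \<open>n\<close>-periodic function with
  \<open>\<sigma> i = e\<^sub>i\<close>, so that indices beyond \<open>n\<close> are automatically read modulo \<open>n\<close>.\<close>

definition cyclic_ordering :: "'a set \<Rightarrow> (nat \<Rightarrow> 'a) \<Rightarrow> bool" where
  "cyclic_ordering E \<sigma> \<longleftrightarrow>
     bij_betw \<sigma> {1..card E} E \<and> (\<forall>i. \<sigma> (i + card E) = \<sigma> i)"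

definition t_circuit :: "'a matroid_structure \<Rightarrow> nat \<Rightarrow> 'a set \<Rightarrow> bool" where
  "t_circuit M t C \<longleftrightarrow> circuit M C \<and> card C = t"

definition t_cocircuit :: "'a matroid_structure \<Rightarrow> nat \<Rightarrow> 'a set \<Rightarrow> bool" where
  "t_cocircuit M t C \<longleftrightarrow> cocircuit M C \<and> card C = t"

definition t_cyclic_ordering :: "'a matroid_structure \<Rightarrow> nat \<Rightarrow> (nat \<Rightarrow> 'a) \<Rightarrow> bool" where
  "t_cyclic_ordering M t \<sigma> \<longleftrightarrow>
     1 \<le> t \<and> t + 1 \<le> card (ground M) \<and> cyclic_ordering (ground M) \<sigma> \<and>
     (\<forall>i \<in> {1..card (ground M)}. odd i \<longrightarrow>
        (t_circuit M t (\<sigma> ` {i..i + t - 1}) \<and> t_cocircuit M t (\<sigma> ` {i + 1..i + t})) \<or>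
        (t_circuit M t (\<sigma> ` {i..i + t - 1}) \<and> t_cocircuit M t (\<sigma> ` {i..i + t - 1})))"

definition t_cyclic :: "'a matroid_structure \<Rightarrow> nat \<Rightarrow> bool" where
  "t_cyclic M t \<longleftrightarrow> matroid M \<and> (\<exists>\<sigma>. t_cyclic_ordering M t \<sigma>)"

definition even_t_cyclic_ordering :: "'a matroid_structure \<Rightarrow> nat \<Rightarrow> (nat \<Rightarrow> 'a) \<Rightarrow> bool" where
  "even_t_cyclic_ordering M t \<sigma> \<longleftrightarrow>
     t_cyclic_ordering M t \<sigma> \<and>
     (\<forall>i \<in> {1..card (ground M)}. odd i \<longrightarrow>
        t_circuit M t (\<sigma> ` {i..i + t - 1}) \<and> t_cocircuit M t (\<sigma> ` {i..i + t - 1}))"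

text \<open>In the next definition \<open>s i\<close> is the position at which the block \<open>Ps ! i\<close> starts; the last
  block ends just before position \<open>s 0 + card E\<close>, i.e. after exactly one turn around the cycle.
  As \<open>\<sigma>\<close> is a cyclic ordering of \<open>E\<close>, the blocks partition \<open>E\<close>.\<close>

definition concatenation :: "'a set \<Rightarrow> (nat \<Rightarrow> 'a) \<Rightarrow> 'a set list \<Rightarrow> bool" where
  "concatenation E \<sigma> Ps \<longleftrightarrow>
     (\<exists>s. (\<forall>i < length Ps. s i < s (Suc i) \<and> Ps ! i = \<sigma> ` {s i..<s (Suc i)}) \<and>
          s (length Ps) = s 0 + card E)"

text \<open>The bound \<open>j < card E\<close> makes \<open>j + 1\<close> an index in \<open>{1..card E}\<close>, so its parity is
  meaningful.\<close>

definition even_concatenation :: "'a set \<Rightarrow> nat \<Rightarrow> (nat \<Rightarrow> 'a) \<Rightarrow> 'a set list \<Rightarrow> bool" where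
  "even_concatenation E t \<sigma> Ps \<longleftrightarrow>
     concatenation E \<sigma> Ps \<and>
     (\<forall>P \<in> set Ps. t \<le> card P + 2 \<and> even (card P) \<and>
        (\<exists>j < card E. odd (j + 1) \<and> P = \<sigma> ` {j + 1..j + card P}))"


section \<open>Flowers\<close>

text \<open>The petals \<open>P\<^sub>1, \<dots>, P\<^sub>m\<close> are \<open>Ps ! 0, \<dots>, Ps ! (m - 1)\<close>.\<close>

definition is_partition :: "'a set \<Rightarrow> 'a set list \<Rightarrow> bool" where
  "is_partition E Ps \<longleftrightarrow>
     \<Union> (set Ps) = E \<and> (\<forall>P \<in> set Ps. P \<noteq> {}) \<and>
     (\<forall>i < length Ps. \<forall>j < length Ps. i \<noteq> j \<longrightarrow> Ps ! i \<inter> Ps ! j = {})"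

definition flower :: "'a matroid_structure \<Rightarrow> nat \<Rightarrow> 'a set list \<Rightarrow> bool" where
  "flower M k Ps \<longleftrightarrow>
     1 < length Ps \<and> is_partition (ground M) Ps \<and>
     (\<forall>P \<in> set Ps. exactly_separating M k P) \<and>
     (3 \<le> length Ps \<longrightarrow>
        (\<forall>i < length Ps. exactly_separating M k (Ps ! i \<union> Ps ! (Suc i mod length Ps))))"

definition cyclically_consecutive :: "nat \<Rightarrow> nat set \<Rightarrow> bool" where
  "cyclically_consecutive m I \<longleftrightarrow> (\<exists>a l. I = (\<lambda>i. i mod m) ` {a..<a + l})"

definition anemone :: "'a matroid_structure \<Rightarrow> nat \<Rightarrow> 'a set list \<Rightarrow> bool" where
  "anemone M k Ps \<longleftrightarrow>
     flower M k Ps \<and>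
     (\<forall>I. I \<noteq> {} \<and> I \<subset> {..<length Ps} \<longrightarrow> exactly_separating M k (\<Union>i\<in>I. Ps ! i))"

definition daisy :: "'a matroid_structure \<Rightarrow> nat \<Rightarrow> 'a set list \<Rightarrow> bool" where
  "daisy M k Ps \<longleftrightarrow>
     flower M k Ps \<and>
     (\<forall>I. I \<noteq> {} \<and> I \<subset> {..<length Ps} \<longrightarrow>
        (exactly_separating M k (\<Union>i\<in>I. Ps ! i) \<longleftrightarrow> cyclically_consecutive (length Ps) I))"

end

theory Submission
  imports Defs
begin

text \<open>
  Write \<open>t = 2 * w + 2\<close> with \<open>w \<ge> 1\<close> and group \<open>2 * N\<close> elements, \<open>N = 4 * w\<close>, into \<open>N\<close> pairs
  (\<^emph>\<open>legs\<close>) \<open>{2 * l, 2 * l + 1}\<close>. Let \<open>c\<close> be a symmetric submodular function on sets of legs with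
  \<open>c {} = 0\<close> that is positive on proper non-empty sets. Call a set \<open>I\<close> of elements independent if, for
  every set \<open>A\<close> of legs, it has at most \<open>card A + w * c A\<close> elements in the legs of \<open>A\<close>. This is a
  matroid \<open>M\<close> by Edmonds' uncrossing argument (\<open>augment\<close>): the sets \<open>A\<close> where the bound is attained are
  closed under union. Its rank is \<open>N\<close>, and because \<open>c\<close> is symmetric the complement of a basis is a
  basis, so \<open>M\<close> is its own dual (\<open>dual_cut_matroid\<close>).

  A set \<open>A\<close> of legs with \<open>c A = 1\<close> therefore behaves as in a generalised spike: \<open>w + 1\<close> such
  legs form a circuit, hence also a cocircuit, of size \<open>t\<close> (\<open>circuit_block\<close>); and if \<open>A\<close> and its complement
  have at least \<open>w\<close> legs each, then \<open>A\<close> has rank \<open>card A + w\<close>, whence \<open>\<lambda>(A) = 2 * w = (t - 1) - 1\<close>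
  (\<open>connectivity_block_eq\<close>). So if \<open>c\<close> is \<open>1\<close> on all proper non-empty cyclic intervals of legs, the
  natural ordering is an even \<open>t\<close>-cyclic ordering, and cutting it into four petals of \<open>w\<close> legs gives a
  flower.

  The two parts come from two choices of \<open>c\<close>. If \<open>c\<close> is \<open>1\<close> on every proper non-empty set, the result is a
  free \<open>(w + 1)\<close>-spike, in which the four petals form an anemone. If \<open>c A\<close> is the number of maximal
  cyclic intervals of \<open>A\<close> (half of the size of an edge cut in the cycle), the result is the
  analogue of a free swirl. There the union of two opposite petals contains an independent set with
  \<open>w + 1\<close> elements more than legs (\<open>opposite_rank\<close>), which makes its connectivity exceed \<open>2 * w\<close>,
  so the petals form a daisy.
\<close>

section \<open>Blocks and arcs\<close>

text \<open>Numbers are grouped into consecutive blocks of \<open>k\<close>. With \<open>k = 2\<close> this passes from legs to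
  elements, with \<open>k = w\<close> from petals to legs.\<close>

definition block :: "nat \<Rightarrow> nat set \<Rightarrow> nat set" where
  "block k A = {x. x div k \<in> A}"

definition arc :: "nat \<Rightarrow> nat \<Rightarrow> nat \<Rightarrow> nat set" where
  "arc n a l = (\<lambda>i. i mod n) ` {a..<a + l}"

lemma block_Un: "block k (A \<union> B) = block k A \<union> block k B"
  and block_Int: "block k (A \<inter> B) = block k A \<inter> block k B"
  and block_Diff: "block k (A - B) = block k A - block k B"
  and block_empty: "block k {} = {}"
  and block_mono: "A \<subseteq> B \<Longrightarrow> block k A \<subseteq> block k B"
  by (auto simp: block_def)

lemma block_lessThan:
  assumes "0 < k" shows "block k {..<n} = {..<k * n}"
  using assms by (auto simp: block_def div_less_iff_less_mult mult.commute)

lemma finite_block: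
  assumes "0 < k" "finite A" shows "finite (block k A)"
proof -
  obtain n where "A \<subseteq> {..<n}"
    using assms(2) unfolding finite_nat_set_iff_bounded by blast
  then have "block k A \<subseteq> {..<k * n}"
    using block_mono block_lessThan[OF assms(1)] by metis
  then show ?thesis by (rule finite_subset) simp
qed

lemma card_block:
  assumes k: "0 < k" shows "card (block k A) = k * card A"
proof -
  have "bij_betw (\<lambda>(a, r). k * a + r) (A \<times> {..<k}) (block k A)"
    by (rule bij_betw_byWitness[where f' = "\<lambda>x. (x div k, x mod k)"])
      (use k in \<open>auto simp: block_def\<close>)
  from bij_betw_same_card[OF this] show ?thesis by (simp add: card_cartesian_product mult.commute)
qed

text \<open>Blowing up by a factor \<open>k\<close> maps cyclic intervals to cyclic intervals. This one fact identifies
  consecutive petals with intervals of legs, and intervals of legs with segments of the ordering.\<close>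

lemma block_arc:
  assumes k: "0 < k"
  shows "block k (arc n a l) = arc (k * n) (k * a) (k * l)"
proof (intro set_eqI iffI)
  fix x assume "x \<in> block k (arc n a l)"
  then obtain j where j: "a \<le> j" "j < a + l" "x div k = j mod n"
    by (auto simp: block_def arc_def)
  have "x = (k * j + x mod k) mod (k * n)"
    using k j(3) by (simp add: mod_mult2_eq) (metis mult_div_mod_eq)
  moreover have "k * a \<le> k * j + x mod k" using j(1) by (simp add: trans_le_add1)
  moreover have "k * j + x mod k < k * a + k * l"
  proof -
    have "k * j + x mod k < k * Suc j" using k by simp
    also have "\<dots> \<le> k * (a + l)" using j(2) by (intro mult_le_mono2) simp
    finally show ?thesis by (simp add: algebra_simps)
  qed
  ultimately show "x \<in> arc (k * n) (k * a) (k * l)"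
    unfolding arc_def by (intro image_eqI[where x = "k * j + x mod k"]) auto
next
  fix x assume "x \<in> arc (k * n) (k * a) (k * l)"
  then obtain y where y: "k * a \<le> y" "y < k * a + k * l" "x = y mod (k * n)"
    by (auto simp: arc_def)
  have "x div k = (y div k) mod n" using k y(3) by (simp add: mod_mult2_eq)
  moreover have "a \<le> y div k" using y(1) k by (simp add: less_eq_div_iff_mult_less_eq mult.commute)
  moreover have "y div k < a + l"
    using y(2) k by (simp add: div_less_iff_less_mult algebra_simps)
  ultimately show "x \<in> block k (arc n a l)"
    by (auto simp: block_def arc_def)
qed

lemma arc_subset: "0 < n \<Longrightarrow> arc n a l \<subseteq> {..<n}"
  by (auto simp: arc_def)

lemma card_arc:
  assumes "l \<le> n" shows "card (arc n a l) = l"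
proof -
  have "inj_on (\<lambda>i. i mod n) {a..<a + l}"
  proof (rule inj_onI)
    fix x y assume xy: "x \<in> {a..<a + l}" "y \<in> {a..<a + l}" "x mod n = y mod n"
    have *: "u = v" if "u \<le> v" "v < u + n" "u mod n = v mod n" for u v
    proof -
      have "n dvd v - u" using that by (metis mod_eq_dvd_iff_nat)
      moreover have "v - u < n" using that by linarith
      ultimately show ?thesis using that(1) nat_dvd_not_less[of "v - u" n] by fastforce
    qed
    show "x = y"
    proof (cases "x \<le> y")
      case True
      show ?thesis by (rule *) (use xy assms True in auto)
    next
      case False
      show ?thesis by (rule *[symmetric]) (use xy assms False in auto)
    qed
  qed
  then show ?thesis by (simp add: arc_def card_image)
qed

lemma arc_proper:
  assumes "0 < l" "l < n" shows "arc n a l \<noteq> {}" "arc n a l \<noteq> {..<n}"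
proof -
  have "card (arc n a l) = l" by (rule card_arc) (use assms in simp)
  then show "arc n a l \<noteq> {}" "arc n a l \<noteq> {..<n}" using assms by force+
qed

lemma arc_full:
  assumes "n \<le> l" "0 < n" shows "arc n a l = {..<n}"
proof -
  have "arc n a n \<subseteq> arc n a l" using assms by (auto simp: arc_def)
  moreover have "arc n a n = {..<n}"
    by (rule card_subset_eq) (use assms arc_subset card_arc[of n n a] in auto)
  ultimately show ?thesis using arc_subset[OF assms(2)] by blast
qed

section \<open>Matroids from symmetric submodular functions\<close>

text \<open>The test sets for independence: one element from each leg in \<open>A\<close>, and both elements from
  each leg in \<open>F\<close>.\<close>

definition doubled :: "nat set \<Rightarrow> nat set \<Rightarrow> nat set" where
  "doubled A F = (\<lambda>l. 2 * l) ` A \<union> (\<lambda>l. 2 * l + 1) ` F"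

lemma doubled_subset: "F \<subseteq> A \<Longrightarrow> doubled A F \<subseteq> block 2 A"
  by (auto simp: doubled_def block_def)

lemma card_doubled:
  assumes "finite A" "finite F"
  shows "card (doubled A F) = card A + card F"
proof -
  have "(\<lambda>l. 2 * l) ` A \<inter> (\<lambda>l. 2 * l + 1) ` F = {}" by auto presburger
  then show ?thesis
    using assms by (simp add: doubled_def card_Un_disjoint card_image inj_on_def)
qed

lemma doubled_Int_block: "doubled A F \<inter> block 2 B = doubled (A \<inter> B) (F \<inter> B)"
  by (auto simp: doubled_def block_def)

text \<open>The number \<open>w\<close> is only a scaling factor: the matroid below is governed by the symmetric submodular
  function \<open>w * c\<close>.\<close>

locale symmetric_cut =
  fixes N :: nat and w :: nat and c :: "nat set \<Rightarrow> nat"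
  assumes cut_empty: "c {} = 0"
    and cut_compl: "A \<subseteq> {..<N} \<Longrightarrow> c ({..<N} - A) = c A"
    and cut_submodular: "\<lbrakk>A \<subseteq> {..<N}; B \<subseteq> {..<N}\<rbrakk> \<Longrightarrow> c (A \<union> B) + c (A \<inter> B) \<le> c A + c B"
    and cut_pos: "\<lbrakk>A \<subseteq> {..<N}; A \<noteq> {}; A \<noteq> {..<N}\<rbrakk> \<Longrightarrow> 1 \<le> c A"
begin

definition cut_matroid :: "nat matroid_structure" where
  "cut_matroid = \<lparr>ground = block 2 {..<N},
     indeps = {I. I \<subseteq> block 2 {..<N} \<and> (\<forall>A\<subseteq>{..<N}. card (I \<inter> block 2 A) \<le> card A + w * c A)}\<rparr>"

lemma ground_cut_matroid: "ground cut_matroid = block 2 {..<N}"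
  by (simp add: cut_matroid_def)

lemma indep_iff:
  "I \<in> indeps cut_matroid \<longleftrightarrow>
    I \<subseteq> block 2 {..<N} \<and> (\<forall>A\<subseteq>{..<N}. card (I \<inter> block 2 A) \<le> card A + w * c A)"
  by (simp add: cut_matroid_def)

lemma finite_ground_block: "finite (block 2 {..<N})"
  by (simp add: finite_block)

lemma finite_indep: "I \<in> indeps cut_matroid \<Longrightarrow> finite I"
  using finite_ground_block finite_subset by (auto simp: indep_iff)

lemma cut_full: "c {..<N} = 0"
  using cut_compl[of "{}"] cut_empty by simp

lemma card_indep_le: "I \<in> indeps cut_matroid \<Longrightarrow> card I \<le> N"
  using cut_full by (auto simp: indep_iff inf_absorb1 dest!: spec[of _ "{..<N}"])

text \<open>Uncrossing: the left-hand side of the defining bound is modular in \<open>A\<close> and the right-hand side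
  is submodular, so equality for two sets forces equality for their union.\<close>

lemma tight_Un:
  assumes I: "I \<in> indeps cut_matroid"
    and A: "A \<subseteq> {..<N}" "card (I \<inter> block 2 A) = card A + w * c A"
    and B: "B \<subseteq> {..<N}" "card (I \<inter> block 2 B) = card B + w * c B"
  shows "card (I \<inter> block 2 (A \<union> B)) = card (A \<union> B) + w * c (A \<union> B)"
proof -
  have fin: "finite A" "finite B" "finite I"
    using A(1) B(1) finite_subset finite_indep[OF I] by blast+
  have "card (I \<inter> block 2 A) + card (I \<inter> block 2 B)
      = card (I \<inter> block 2 (A \<union> B)) + card (I \<inter> block 2 (A \<inter> B))"
    using card_Un_Int[of "I \<inter> block 2 A" "I \<inter> block 2 B"] fin
    by (simp add: block_Un block_Int Int_Un_distrib Int_ac)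
  moreover have "card A + card B = card (A \<union> B) + card (A \<inter> B)"
    using card_Un_Int fin by blast
  moreover have "w * c (A \<union> B) + w * c (A \<inter> B) \<le> w * c A + w * c B"
    using mult_le_mono2[OF cut_submodular[OF A(1) B(1)], of w] by (simp add: algebra_simps)
  moreover have "card (I \<inter> block 2 (A \<inter> B)) \<le> card (A \<inter> B) + w * c (A \<inter> B)"
    "card (I \<inter> block 2 (A \<union> B)) \<le> card (A \<union> B) + w * c (A \<union> B)"
    using I A(1) B(1) unfolding indep_iff by (meson le_infI1 Un_least)+
  ultimately show ?thesis using A(2) B(2) by linarith
qed

lemma tight_Union:
  assumes I: "I \<in> indeps cut_matroid" and "finite \<A>"
    and "\<And>A. A \<in> \<A> \<Longrightarrow> A \<subseteq> {..<N} \<and> card (I \<inter> block 2 A) = card A + w * c A"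
  shows "card (I \<inter> block 2 (\<Union>\<A>)) = card (\<Union>\<A>) + w * c (\<Union>\<A>)"
  using assms(2,3)
proof (induction \<A>)
  case empty
  then show ?case by (simp add: block_empty cut_empty)
next
  case (insert A \<A>)
  have "\<Union>\<A> \<subseteq> {..<N}" using insert.prems by blast
  then have "card (I \<inter> block 2 (A \<union> \<Union>\<A>)) = card (A \<union> \<Union>\<A>) + w * c (A \<union> \<Union>\<A>)"
    by (intro tight_Un[OF I]) (use insert in auto)
  then show ?case by simp
qed

lemma not_indep_insert:
  assumes I: "I \<in> indeps cut_matroid" and y: "y \<in> block 2 {..<N}" "insert y I \<notin> indeps cut_matroid"
  obtains A where "A \<subseteq> {..<N}" "y \<in> block 2 A" "card (I \<inter> block 2 A) = card A + w * c A"
proof -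
  have fin: "finite I" by (rule finite_indep[OF I])
  obtain A where A: "A \<subseteq> {..<N}" "card (insert y I \<inter> block 2 A) > card A + w * c A"
    using I y by (auto simp: indep_iff not_le)
  have le: "card (I \<inter> block 2 A) \<le> card A + w * c A"
    using I A(1) by (auto simp: indep_iff)
  have yA: "y \<in> block 2 A"
  proof (rule ccontr)
    assume "y \<notin> block 2 A"
    then have "insert y I \<inter> block 2 A = I \<inter> block 2 A" by auto
    with A(2) le show False by simp
  qed
  then have "insert y I \<inter> block 2 A = insert y (I \<inter> block 2 A)" by auto
  then have "card (insert y I \<inter> block 2 A) \<le> Suc (card (I \<inter> block 2 A))"
    using fin by (simp add: card_insert_if)
  with A le yA that show thesis by auto
qed

text \<open>If no element of \<open>J - I\<close> can be added, each lies in the legs of a tight set, so all lie in the legs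
  of the union \<open>T\<close> of the tight sets. Inside \<open>T\<close> the set \<open>I\<close> is as large as any independent set
  can be, and outside it contains all of \<open>J\<close>, so \<open>card J \<le> card I\<close>.\<close>

lemma augment:
  assumes I: "I \<in> indeps cut_matroid" and J: "J \<in> indeps cut_matroid" and less: "card I < card J"
  shows "\<exists>y\<in>J - I. insert y I \<in> indeps cut_matroid"
proof (rule ccontr)
  assume neg: "\<not> ?thesis"
  have finI: "finite I" and finJ: "finite J" using I J finite_indep by blast+
  define \<A> where "\<A> = {A. A \<subseteq> {..<N} \<and> card (I \<inter> block 2 A) = card A + w * c A}"
  have "\<A> \<subseteq> Pow {..<N}" by (auto simp: \<A>_def)
  then have "finite \<A>" by (rule finite_subset) simp
  then have tight: "card (I \<inter> block 2 (\<Union>\<A>)) = card (\<Union>\<A>) + w * c (\<Union>\<A>)"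
    by (intro tight_Union[OF I]) (auto simp: \<A>_def)
  have sub: "\<Union>\<A> \<subseteq> {..<N}" by (auto simp: \<A>_def)
  have cov: "J - I \<subseteq> block 2 (\<Union>\<A>)"
  proof
    fix y assume y: "y \<in> J - I"
    then obtain A where "A \<subseteq> {..<N}" "y \<in> block 2 A" "card (I \<inter> block 2 A) = card A + w * c A"
      using not_indep_insert[OF I, of y] neg J by (auto simp: indep_iff)
    then show "y \<in> block 2 (\<Union>\<A>)" by (auto simp: \<A>_def block_def)
  qed
  have "card J = card (J \<inter> block 2 (\<Union>\<A>)) + card (J - block 2 (\<Union>\<A>))"
    using finJ by (metis card_Int_Diff)
  also have "\<dots> \<le> card (I \<inter> block 2 (\<Union>\<A>)) + card (I - block 2 (\<Union>\<A>))"
  proof (rule add_mono)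
    show "card (J \<inter> block 2 (\<Union>\<A>)) \<le> card (I \<inter> block 2 (\<Union>\<A>))"
      using J sub by (simp add: tight indep_iff)
    show "card (J - block 2 (\<Union>\<A>)) \<le> card (I - block 2 (\<Union>\<A>))"
      using cov finI by (intro card_mono) auto
  qed
  also have "\<dots> = card I" using finI by (metis card_Int_Diff)
  finally show False using less by simp
qed

lemma indep_mono:
  assumes X: "X \<in> indeps cut_matroid" and YX: "Y \<subseteq> X" shows "Y \<in> indeps cut_matroid"
proof -
  have "card (Y \<inter> block 2 A) \<le> card (X \<inter> block 2 A)" for A
    using finite_indep[OF X] YX by (intro card_mono) auto
  then show ?thesis using X YX unfolding indep_iff by (blast intro: order_trans)
qed

lemma matroid_cut_matroid: "matroid cut_matroid"
proof
  show "finite (ground cut_matroid)" by (simp add: ground_cut_matroid finite_ground_block)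
  show "\<And>X. X \<in> indeps cut_matroid \<Longrightarrow> X \<subseteq> ground cut_matroid"
    by (simp add: ground_cut_matroid indep_iff)
  show "{} \<in> indeps cut_matroid" by (simp add: indep_iff)
qed (fact indep_mono augment)+

lemma doubled_indep:
  assumes "A \<subseteq> {..<N}" "F \<subseteq> A"
    and "\<And>B. \<lbrakk>B \<subseteq> {..<N}\<rbrakk> \<Longrightarrow> card (A \<inter> B) + card (F \<inter> B) \<le> card B + w * c B"
  shows "doubled A F \<in> indeps cut_matroid"
proof -
  have fin: "finite A" "finite F"
    using assms(1,2) by (meson finite_lessThan finite_subset)+
  have "doubled A F \<subseteq> block 2 {..<N}"
    using doubled_subset[OF assms(2)] block_mono[OF assms(1)] by blast
  then show ?thesis
    using fin assms(3) by (auto simp: indep_iff doubled_Int_block card_doubled)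
qed

text \<open>With at most \<open>w\<close> full legs, the excess over the number of legs is at most \<open>w\<close>, which every proper
  non-empty set of legs allows; only the bound by the rank \<open>N\<close> remains.\<close>

lemma sparse_doubled_indep:
  assumes A: "A \<subseteq> {..<N}" and F: "F \<subseteq> A" "card F \<le> w" and le: "card A + card F \<le> N"
  shows "doubled A F \<in> indeps cut_matroid"
proof (rule doubled_indep[OF A F(1)])
  fix B assume B: "B \<subseteq> {..<N}"
  have fin: "finite B" "finite F" using A B F finite_subset[of _ "{..<N}"] by blast+
  have AB: "card (A \<inter> B) \<le> card B" and FB: "card (F \<inter> B) \<le> card F"
    using fin by (auto intro!: card_mono)
  show "card (A \<inter> B) + card (F \<inter> B) \<le> card B + w * c B"
  proof (cases "B = {} \<or> B = {..<N}")
    case True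
    then show ?thesis using A F le by (auto simp: inf_absorb1)
  next
    case False
    then have "w \<le> w * c B" using cut_pos[OF B] by simp
    then show ?thesis using AB FB F(2) by linarith
  qed
qed

lemma basis_card_iff: "basis cut_matroid B \<longleftrightarrow> B \<in> indeps cut_matroid \<and> card B = N"
proof
  assume B: "basis cut_matroid B"
  have T: "doubled {..<N} {} \<in> indeps cut_matroid" "card (doubled {..<N} {}) = N"
    using sparse_doubled_indep[of "{..<N}" "{}"] by (simp_all add: card_doubled)
  have "\<not> card B < N"
  proof
    assume "card B < N"
    then obtain y where "y \<notin> B" "insert y B \<in> indeps cut_matroid"
      using augment[of B "doubled {..<N} {}"] T B by (auto simp: basis_def)
    then show False using B by (auto simp: basis_def)
  qed
  then show "B \<in> indeps cut_matroid \<and> card B = N"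
    using B card_indep_le[of B] by (auto simp: basis_def)
next
  assume B: "B \<in> indeps cut_matroid \<and> card B = N"
  then show "basis cut_matroid B"
    unfolding basis_def using card_indep_le finite_indep card_seteq by metis
qed

text \<open>For a basis \<open>B\<close>, having size \<open>N\<close>, the excess of the complement over \<open>A\<close> equals the excess of \<open>B\<close>
  over the complement of \<open>A\<close>; the bounds for the two agree by the symmetry of \<open>c\<close>.\<close>

lemma basis_compl:
  assumes "basis cut_matroid B" shows "basis cut_matroid (block 2 {..<N} - B)"
proof -
  have B: "B \<subseteq> block 2 {..<N}" "card B = N"
    and Bi: "\<And>A. A \<subseteq> {..<N} \<Longrightarrow> card (B \<inter> block 2 A) \<le> card A + w * c A"
    using assms by (auto simp: basis_card_iff indep_iff)
  have finB: "finite B" using B(1) finite_ground_block finite_subset by blast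
  have "card ((block 2 {..<N} - B) \<inter> block 2 A) \<le> card A + w * c A" if A: "A \<subseteq> {..<N}" for A
  proof -
    have finA: "finite A" using A finite_subset by blast
    have "(block 2 {..<N} - B) \<inter> block 2 A = block 2 A - B \<inter> block 2 A"
      using block_mono[OF A] by auto
    then have 1: "card ((block 2 {..<N} - B) \<inter> block 2 A) = 2 * card A - card (B \<inter> block 2 A)"
      using finB by (simp add: card_Diff_subset card_block)
    have "B \<inter> block 2 ({..<N} - A) = B - B \<inter> block 2 A"
      using B(1) by (auto simp: block_Diff)
    then have 2: "card (B \<inter> block 2 ({..<N} - A)) = N - card (B \<inter> block 2 A)"
      using finB B(2) by (simp add: card_Diff_subset)
    have 3: "card (B \<inter> block 2 ({..<N} - A)) \<le> N - card A + w * c A"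
      using Bi[of "{..<N} - A"] cut_compl[OF A] A finA by (simp add: card_Diff_subset)
    have "card A \<le> N" using card_mono[OF _ A] by simp
    then show ?thesis using 1 2 3 by linarith
  qed
  moreover have "card (block 2 {..<N} - B) = N"
    using B finB by (simp add: card_Diff_subset card_block)
  ultimately show ?thesis by (auto simp: basis_card_iff indep_iff)
qed

lemma indep_extends_to_basis:
  assumes "X \<in> indeps cut_matroid" obtains B where "basis cut_matroid B" "X \<subseteq> B"
proof -
  let ?S = "{Y \<in> indeps cut_matroid. X \<subseteq> Y}"
  have "?S \<subseteq> Pow (block 2 {..<N})" by (auto simp: indep_iff)
  then have "finite ?S" by (rule finite_subset) (simp add: finite_ground_block)
  then obtain B where "B \<in> ?S" "\<And>Y. Y \<in> ?S \<Longrightarrow> B \<subseteq> Y \<Longrightarrow> Y = B"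
    using finite_has_maximal[of ?S] assms by (metis (mono_tags, lifting) empty_iff mem_Collect_eq order_refl)
  then have "basis cut_matroid B" "X \<subseteq> B" by (auto simp: basis_def)
  then show thesis by (rule that)
qed

lemma dual_cut_matroid: "dual cut_matroid = cut_matroid"
proof -
  have "(\<exists>B. basis cut_matroid B \<and> X \<subseteq> block 2 {..<N} - B) \<longleftrightarrow> X \<in> indeps cut_matroid" for X
  proof
    assume "\<exists>B. basis cut_matroid B \<and> X \<subseteq> block 2 {..<N} - B"
    then show "X \<in> indeps cut_matroid"
      using basis_compl indep_mono basis_card_iff by blast
  next
    assume X: "X \<in> indeps cut_matroid"
    then obtain B where "basis cut_matroid B" "X \<subseteq> B" by (rule indep_extends_to_basis)
    then have "basis cut_matroid (block 2 {..<N} - B)" "X \<subseteq> block 2 {..<N} - (block 2 {..<N} - B)"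
      using basis_compl X by (auto simp: indep_iff)
    then show "\<exists>B. basis cut_matroid B \<and> X \<subseteq> block 2 {..<N} - B" by blast
  qed
  then show ?thesis
    by (simp add: dual_def ground_cut_matroid)
qed

lemma cocircuit_iff_circuit: "cocircuit cut_matroid C \<longleftrightarrow> circuit cut_matroid C"
  by (simp add: cocircuit_def dual_cut_matroid)

text \<open>The \<open>2 * w + 2\<close> elements exceed the bound \<open>card A + w = 2 * w + 1\<close> by one. After removing an
  element, a set \<open>B \<supseteq> A\<close> meets the bound by counting all elements, and any other \<open>B\<close> meets it because it
  contains at most \<open>w\<close> legs of \<open>A\<close>.\<close>

lemma circuit_block:
  assumes A: "A \<subseteq> {..<N}" and card: "card A = w + 1" and c: "c A = 1" and N: "2 * w + 1 \<le> N"
  shows "circuit cut_matroid (block 2 A)"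
proof -
  have finA: "finite A" using A finite_subset by blast
  have "block 2 A \<notin> indeps cut_matroid"
    using A card c by (auto simp: indep_iff card_block intro!: exI[of _ A])
  moreover have "X \<in> indeps cut_matroid" if X: "X \<subset> block 2 A" for X
  proof -
    have finX: "finite X"
      using X finA finite_block[of 2 A] finite_subset by (metis zero_less_numeral psubset_imp_subset)
    have cardX: "card X \<le> 2 * w + 1"
      using psubset_card_mono[OF _ X] finite_block[of 2 A] finA card by (simp add: card_block)
    have "card (X \<inter> block 2 B) \<le> card B + w * c B" if B: "B \<subseteq> {..<N}" for B
    proof (cases "B = {} \<or> B = {..<N}")
      case True
      have "card (X \<inter> block 2 B) \<le> card X" using finX by (auto intro: card_mono)
      then show ?thesis using True cardX N by (auto simp: block_empty)
    next
      case False
      have finB: "finite B" using B finite_subset by blast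
      have "w \<le> w * c B" using cut_pos[OF B] False by simp
      moreover have "card (X \<inter> block 2 B) \<le> card B + w"
      proof (cases "A \<subseteq> B")
        case True
        have "card (X \<inter> block 2 B) \<le> card X" using finX by (auto intro: card_mono)
        moreover have "card A \<le> card B" using True finB by (rule card_mono[rotated])
        ultimately show ?thesis using cardX card by simp
      next
        case False
        then have "A \<inter> B \<subset> A" by auto
        then have lt: "card (A \<inter> B) < card A" by (rule psubset_card_mono[OF finA])
        have "X \<inter> block 2 B \<subseteq> block 2 (A \<inter> B)" using X by (auto simp: block_Int)
        then have "card (X \<inter> block 2 B) \<le> 2 * card (A \<inter> B)"
          using card_mono[OF finite_block[of 2 "A \<inter> B"]] finA by (simp add: card_block)
        moreover have "card (A \<inter> B) \<le> card B" using finB by (auto intro: card_mono)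
        ultimately show ?thesis using lt card by simp
      qed
      ultimately show ?thesis by linarith
    qed
    then show ?thesis using X block_mono[OF A, of 2] by (auto simp: indep_iff)
  qed
  ultimately show ?thesis
    using block_mono[OF A, of 2] by (auto simp: circuit_def ground_cut_matroid)
qed

lemma indep_le_rank:
  assumes "I \<in> indeps cut_matroid" "I \<subseteq> X" shows "card I \<le> rank cut_matroid X"
proof -
  have "{card I |I. I \<in> indeps cut_matroid \<and> I \<subseteq> X} \<subseteq> {..N}"
    using card_indep_le by auto
  then have "finite {card I |I. I \<in> indeps cut_matroid \<and> I \<subseteq> X}"
    by (rule finite_subset) simp
  then show ?thesis unfolding rank_def by (rule Max_ge) (use assms in auto)
qed

lemma rank_le:
  assumes "\<And>I. I \<in> indeps cut_matroid \<Longrightarrow> I \<subseteq> X \<Longrightarrow> card I \<le> b"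
  shows "rank cut_matroid X \<le> b"
proof -
  let ?S = "{card I |I. I \<in> indeps cut_matroid \<and> I \<subseteq> X}"
  have "?S \<subseteq> {..N}" using card_indep_le by auto
  then have "finite ?S" by (rule finite_subset) simp
  moreover have "card ({} :: nat set) \<in> ?S"
    using matroid.empty_indep[OF matroid_cut_matroid] by blast
  ultimately show ?thesis
    unfolding rank_def using assms by (subst Max_le_iff) auto
qed

lemma rank_ground: "rank cut_matroid (ground cut_matroid) = N"
proof (rule antisym)
  show "rank cut_matroid (ground cut_matroid) \<le> N" by (intro rank_le card_indep_le)
  show "N \<le> rank cut_matroid (ground cut_matroid)"
    using indep_le_rank[OF sparse_doubled_indep[of "{..<N}" "{}"], of "ground cut_matroid"]
      doubled_subset[of "{}" "{..<N}"]
    by (simp add: card_doubled ground_cut_matroid)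
qed

lemma rank_block:
  assumes A: "A \<subseteq> {..<N}" and c: "c A = 1" and card: "w \<le> card A" "card A + w \<le> N"
  shows "rank cut_matroid (block 2 A) = card A + w"
proof (rule antisym)
  show "rank cut_matroid (block 2 A) \<le> card A + w"
  proof (rule rank_le)
    fix I assume "I \<in> indeps cut_matroid" "I \<subseteq> block 2 A"
    then show "card I \<le> card A + w"
      using A c by (auto simp: indep_iff inf_absorb1 dest!: spec[of _ A])
  qed
  obtain F where F: "F \<subseteq> A" "card F = w" using card obtain_subset_with_card_n by metis
  have "finite A" using A finite_subset by blast
  then have "card (doubled A F) = card A + w"
    using F finite_subset[OF F(1)] by (simp add: card_doubled)
  then show "card A + w \<le> rank cut_matroid (block 2 A)"
    using indep_le_rank[OF sparse_doubled_indep[OF A F(1)] doubled_subset[OF F(1)]] F card by simp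
qed

lemma connectivity_block:
  assumes "A \<subseteq> {..<N}"
  shows "connectivity cut_matroid (block 2 A) =
    int (rank cut_matroid (block 2 A)) + int (rank cut_matroid (block 2 ({..<N} - A))) - int N"
  using rank_ground by (simp add: connectivity_def ground_cut_matroid block_Diff)

text \<open>By symmetry of \<open>c\<close> the complement satisfies the same hypotheses, and each side exceeds its
  number of legs by \<open>w\<close>.\<close>

lemma connectivity_block_eq:
  assumes A: "A \<subseteq> {..<N}" and c: "c A = 1" and card: "w \<le> card A" "card A + w \<le> N"
  shows "connectivity cut_matroid (block 2 A) = 2 * int w"
proof -
  have finA: "finite A" using A finite_subset by blast
  have co: "card ({..<N} - A) = N - card A" using A finA by (simp add: card_Diff_subset)
  then have "rank cut_matroid (block 2 ({..<N} - A)) = N - card A + w"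
    using rank_block[of "{..<N} - A"] cut_compl[OF A] c card by simp
  then show ?thesis
    using rank_block[OF A c card] connectivity_block[OF A] card by simp
qed

end

section \<open>Four petals\<close>

locale four_petals = symmetric_cut "4 * w" w c for w c +
  assumes width_pos: "0 < w"
    and cut_arc: "\<lbrakk>0 < l; l < 4 * w\<rbrakk> \<Longrightarrow> c (arc (4 * w) a l) = 1"
begin

text \<open>The cyclic ordering \<open>0, 1, \<dots>, 8 * w - 1\<close> of the elements, indexed from \<open>1\<close>. Adding
  \<open>8 * w - 1\<close> instead of subtracting \<open>1\<close> makes it periodic at index \<open>0\<close> as well.\<close>

definition ordering :: "nat \<Rightarrow> nat" where
  "ordering i = (i + 8 * w - 1) mod (8 * w)"

definition petals :: "nat set list" where
  "petals = map (\<lambda>j. block 2 (block w {j})) [0..<4]"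

lemma ground_eq: "ground cut_matroid = {..<8 * w}"
  by (simp add: ground_cut_matroid block_lessThan)

lemma ordering_image: "ordering ` {Suc a..<Suc a + l} = arc (8 * w) a l"
proof -
  have "ordering ` {Suc a..<Suc a + l} = (\<lambda>i. ordering (Suc i)) ` {a..<a + l}"
    by (simp add: image_Suc_atLeastLessThan[symmetric] image_image del: image_Suc_atLeastLessThan)
  then show ?thesis by (simp add: arc_def ordering_def)
qed

lemma cyclic_ordering_ordering: "cyclic_ordering (ground cut_matroid) ordering"
proof -
  have "ordering ` {1..8 * w} = {..<8 * w}"
    using ordering_image[of 0 "8 * w"] arc_full[of "8 * w" "8 * w" 0] width_pos
    by (simp add: atLeastLessThanSuc_atLeastAtMost)
  then have "bij_betw ordering {1..8 * w} {..<8 * w}"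
    unfolding bij_betw_def by (intro conjI eq_card_imp_inj_on) simp_all
  moreover have "ordering (i + 8 * w) = ordering i" for i
  proof -
    have "i + 8 * w + 8 * w - 1 = (i + 8 * w - 1) + 8 * w" using width_pos by linarith
    then show ?thesis by (simp only: ordering_def mod_add_self2)
  qed
  ultimately show ?thesis by (simp add: cyclic_ordering_def ground_eq)
qed

lemma circuit_arc: "t_circuit cut_matroid (2 * w + 2) (arc (8 * w) (2 * q) (2 * w + 2))"
proof -
  have eq: "arc (8 * w) (2 * q) (2 * w + 2) = block 2 (arc (4 * w) q (w + 1))"
    by (simp add: block_arc)
  have "circuit cut_matroid (block 2 (arc (4 * w) q (w + 1)))"
    using width_pos by (intro circuit_block arc_subset card_arc cut_arc) simp_all
  moreover have "card (block 2 (arc (4 * w) q (w + 1))) = 2 * w + 2"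
    using card_arc[of "w + 1" "4 * w" q] width_pos by (simp add: card_block)
  ultimately show ?thesis by (simp only: t_circuit_def eq)
qed

lemma even_t_cyclic_ordering_ordering: "even_t_cyclic_ordering cut_matroid (2 * w + 2) ordering"
proof -
  have *: "t_circuit cut_matroid (2 * w + 2) (ordering ` {i..i + (2 * w + 2) - 1})"
    "t_cocircuit cut_matroid (2 * w + 2) (ordering ` {i..i + (2 * w + 2) - 1})" if i: "odd i" for i
  proof -
    obtain q where q: "i = Suc (2 * q)" using i by (elim oddE) simp
    have "{i..i + (2 * w + 2) - 1} = {Suc (2 * q)..<Suc (2 * q) + (2 * w + 2)}" using q by auto
    then have "ordering ` {i..i + (2 * w + 2) - 1} = arc (8 * w) (2 * q) (2 * w + 2)"
      by (simp only: ordering_image)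
    then show "t_circuit cut_matroid (2 * w + 2) (ordering ` {i..i + (2 * w + 2) - 1})"
      by (simp only: circuit_arc)
    then show "t_cocircuit cut_matroid (2 * w + 2) (ordering ` {i..i + (2 * w + 2) - 1})"
      by (simp only: t_circuit_def t_cocircuit_def cocircuit_iff_circuit)
  qed
  show ?thesis
    unfolding even_t_cyclic_ordering_def t_cyclic_ordering_def
    using * cyclic_ordering_ordering width_pos by (simp only: ground_eq) auto
qed

lemma t_cyclic_cut_matroid: "t_cyclic cut_matroid (2 * w + 2)"
  using even_t_cyclic_ordering_ordering matroid_cut_matroid
  unfolding t_cyclic_def even_t_cyclic_ordering_def by blast

lemma length_petals: "length petals = 4"
  by (simp add: petals_def)

lemma petals_nth: "j < 4 \<Longrightarrow> petals ! j = block 2 (block w {j})"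
  by (simp add: petals_def)

lemma petal_cases:
  assumes "P \<in> set petals" obtains j where "j < 4" "P = petals ! j"
  using assms that unfolding in_set_conv_nth length_petals by blast

lemma petal_eq:
  assumes "j < 4" shows "petals ! j = ordering ` {Suc (2 * w * j)..<Suc (2 * w * j) + 2 * w}"
proof -
  have "{j} = arc 4 j 1" using assms by (simp add: arc_def)
  then show ?thesis
    using assms width_pos
    by (simp only: petals_nth block_arc ordering_image zero_less_numeral) (simp add: mult.assoc)
qed

lemma card_petal: "j < 4 \<Longrightarrow> card (petals ! j) = 2 * w"
  by (simp add: petals_nth card_block width_pos)

lemma even_concatenation_petals:
  "even_concatenation (ground cut_matroid) (2 * w + 2) ordering petals"
proof -
  have "concatenation (ground cut_matroid) ordering petals"
    unfolding concatenation_def length_petals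
    by (intro exI[of _ "\<lambda>j. Suc (2 * w * j)"])
      (use width_pos in \<open>auto simp: petal_eq ground_eq add.commute\<close>)
  moreover have "2 * w + 2 \<le> card P + 2 \<and> even (card P) \<and>
      (\<exists>j < card (ground cut_matroid). odd (j + 1) \<and> P = ordering ` {j + 1..j + card P})"
    if P: "P \<in> set petals" for P
  proof -
    obtain j where j: "j < 4" "P = petals ! j" by (rule petal_cases[OF P])
    have "{Suc (2 * w * j)..<Suc (2 * w * j) + 2 * w} = {2 * w * j + 1..2 * w * j + card P}"
      using j by (simp add: card_petal atLeastLessThanSuc_atLeastAtMost)
    then have "P = ordering ` {2 * w * j + 1..2 * w * j + card P}"
      using petal_eq[OF j(1)] j(2) by metis
    moreover have "2 * w * j < card (ground cut_matroid)"
      using j(1) width_pos by (simp add: ground_eq)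
    moreover have "card P = 2 * w" using j card_petal by simp
    ultimately show ?thesis by (intro conjI exI[of _ "2 * w * j"]) simp_all
  qed
  ultimately show ?thesis by (auto simp: even_concatenation_def)
qed

lemma petals_Union:
  assumes "I \<subseteq> {..<4}" shows "(\<Union>j\<in>I. petals ! j) = block 2 (block w I)"
proof -
  have "(\<Union>j\<in>I. petals ! j) = (\<Union>j\<in>I. block 2 (block w {j}))"
    using assms by (intro SUP_cong refl petals_nth) auto
  then show ?thesis by (auto simp: block_def)
qed

lemma is_partition_petals: "is_partition (ground cut_matroid) petals"
proof -
  have "\<Union> (set petals) = (\<Union>j\<in>{..<4}. petals ! j)"
    by (auto simp: set_conv_nth length_petals)
  also have "\<dots> = ground cut_matroid"
    using width_pos by (simp add: petals_Union ground_eq block_lessThan)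
  finally have "\<Union> (set petals) = ground cut_matroid" .
  moreover have "P \<noteq> {}" if "P \<in> set petals" for P
    using that by (rule petal_cases) (use card_petal width_pos in fastforce)
  ultimately show ?thesis
    by (auto simp: is_partition_def length_petals petals_nth block_def)
qed

lemma exactly_separating_petals:
  assumes I: "I \<noteq> {}" "I \<subset> {..<4}" and c: "c (block w I) = 1"
  shows "exactly_separating cut_matroid (2 * w + 1) (\<Union>j\<in>I. petals ! j)"
proof -
  have sub: "block w I \<subseteq> {..<4 * w}"
    using block_mono[of I "{..<4}" w] I(2) width_pos by (auto simp: block_lessThan mult.commute)
  have fin: "finite I" using I(2) finite_subset by blast
  have "0 < card I" using I(1) fin by (simp add: card_gt_0_iff)
  moreover have "card I < 4" using psubset_card_mono[OF _ I(2)] by simp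
  ultimately have "w * 1 \<le> w * card I" "w * (card I + 1) \<le> w * 4"
    by (intro mult_le_mono2; simp)+
  then have "connectivity cut_matroid (block 2 (block w I)) = 2 * int w"
    by (intro connectivity_block_eq sub c) (use width_pos in \<open>simp_all add: card_block algebra_simps\<close>)
  then show ?thesis
    using I(2) petals_Union[of I] by (auto simp: exactly_separating_def)
qed

lemma cut_consecutive:
  assumes I: "I \<noteq> {}" "I \<subset> {..<4}" and con: "cyclically_consecutive 4 I"
  shows "c (block w I) = 1"
proof -
  obtain a l where al: "I = arc 4 a l"
    using con by (auto simp: cyclically_consecutive_def arc_def)
  have "0 < l" using I(1) al by (cases l) (auto simp: arc_def)
  moreover have "l < 4" using I(2) al arc_full[of 4 l a] by (cases "l < 4") auto
  ultimately have "c (arc (4 * w) (w * a) (w * l)) = 1"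
    using width_pos by (intro cut_arc) simp_all
  then show ?thesis using width_pos by (simp add: al block_arc mult.commute)
qed

lemma consecutive_arc: "cyclically_consecutive n (arc n a l)"
  by (auto simp: cyclically_consecutive_def arc_def)

lemma flower_petals: "flower cut_matroid (2 * w + 1) petals"
proof -
  have sep: "exactly_separating cut_matroid (2 * w + 1) (\<Union>j\<in>arc 4 i l. petals ! j)"
    if "0 < l" "l < 4" for i l
  proof -
    have "arc 4 i l \<subseteq> {..<4}" by (rule arc_subset) simp
    then have arc: "arc 4 i l \<noteq> {}" "arc 4 i l \<subset> {..<4}"
      using arc_proper[OF that] by blast+
    show ?thesis
      by (intro exactly_separating_petals cut_consecutive consecutive_arc arc)
  qed
  have 1: "exactly_separating cut_matroid (2 * w + 1) P" if P: "P \<in> set petals" for P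
  proof -
    obtain j where "j < 4" "P = petals ! j" by (rule petal_cases[OF P])
    moreover have "arc 4 j 1 = {j}" using \<open>j < 4\<close> by (simp add: arc_def)
    ultimately show ?thesis using sep[of 1 j] by simp
  qed
  have 2: "exactly_separating cut_matroid (2 * w + 1) (petals ! i \<union> petals ! (Suc i mod 4))"
    if "i < 4" for i
  proof -
    have "arc 4 i 2 = {i, Suc i mod 4}"
      using that by (simp add: arc_def numeral_2_eq_2 atLeastLessThanSuc)  blast
    then show ?thesis using sep[of 2 i] by simp
  qed
  show ?thesis
    using 1 2 is_partition_petals by (simp add: flower_def length_petals)
qed

end

section \<open>The anemone\<close>

text \<open>For two non-trivial sets the right-hand side of the submodular inequality is already \<open>2\<close>; if one
  set is trivial, union and intersection are the two sets themselves.\<close>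

lemma anemone_four_petals:
  assumes "0 < w"
  shows "four_petals w (\<lambda>A. if A = {} \<or> A = {..<4 * w} then 0 else 1)" (is "four_petals w ?c")
proof
  fix A B :: "nat set" assume AB: "A \<subseteq> {..<4 * w}" "B \<subseteq> {..<4 * w}"
  then show "?c (A \<union> B) + ?c (A \<inter> B) \<le> ?c A + ?c B"
    by (cases "A = {} \<or> A = {..<4 * w}"; cases "B = {} \<or> B = {..<4 * w}")
      (auto simp: Un_absorb1 Un_absorb2 Int_absorb1 Int_absorb2)
next
  fix l a assume "0 < l" "l < 4 * w"
  then show "?c (arc (4 * w) a l) = 1"
    using arc_proper[of l "4 * w" a] by simp
qed (use assms in \<open>auto split: if_splits\<close>)

lemma (in four_petals) anemone_petals:
  assumes "\<And>A. \<lbrakk>A \<subseteq> {..<4 * w}; A \<noteq> {}; A \<noteq> {..<4 * w}\<rbrakk> \<Longrightarrow> c A = 1"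
  shows "anemone cut_matroid (2 * w + 1) petals"
  unfolding anemone_def length_petals
proof (intro conjI flower_petals allI impI)
  fix I :: "nat set" assume I: "I \<noteq> {} \<and> I \<subset> {..<4}"
  have "card I < 4" using psubset_card_mono[of "{..<4}" I] I by simp
  moreover have "0 < card I" using I finite_subset[of I "{..<4}"] by (auto simp: card_gt_0_iff)
  ultimately have "card (block w I) \<noteq> 0" "card (block w I) \<noteq> 4 * w"
    using width_pos by (simp_all add: card_block)
  moreover have "block w I \<subseteq> {..<4 * w}"
    using block_mono[of I "{..<4}" w] I width_pos by (auto simp: block_lessThan mult.commute)
  ultimately have "c (block w I) = 1" by (intro assms) auto
  then show "exactly_separating cut_matroid (2 * w + 1) (\<Union>j\<in>I. petals ! j)"
    using I by (intro exactly_separating_petals) auto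
qed

section \<open>The daisy\<close>

text \<open>The number of steps of the cycle that leave \<open>A\<close>. For a set other than \<open>{}\<close> and \<open>{..<n}\<close> this is its
  number of maximal cyclic intervals.\<close>

definition cycle_cut :: "nat \<Rightarrow> nat set \<Rightarrow> nat" where
  "cycle_cut n A = card {i. i < n \<and> i \<in> A \<and> Suc i mod n \<notin> A}"

text \<open>Going around the cycle, \<open>A\<close> is left as often as it is entered: since the successor map is a
  permutation, as many steps start in \<open>A\<close> as end in \<open>A\<close>, and the steps inside \<open>A\<close> cancel.\<close>

lemma cycle_cut_compl:
  assumes "A \<subseteq> {..<n}" shows "cycle_cut n ({..<n} - A) = cycle_cut n A"
proof (cases "n = 0")
  case False
  have eq: "(\<lambda>i. Suc i mod n) ` {..<n} = {..<n}"
  proof -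
    have "(\<lambda>i. Suc i mod n) ` {..<n} = arc n 1 n"
      unfolding arc_def by (simp add: image_Suc_atLeastLessThan[symmetric] image_image
          lessThan_atLeast0 del: image_Suc_atLeastLessThan)
    then show ?thesis using arc_full[of n n 1] False by simp
  qed
  then have inj: "inj_on (\<lambda>i. Suc i mod n) {..<n}"
    by (intro eq_card_imp_inj_on) simp_all
  have "card {i. i < n \<and> Suc i mod n \<in> A} = card ((\<lambda>i. Suc i mod n) ` {i. i < n \<and> Suc i mod n \<in> A})"
    by (intro card_image[symmetric] inj_on_subset[OF inj]) auto
  also have "(\<lambda>i. Suc i mod n) ` {i. i < n \<and> Suc i mod n \<in> A} = (\<lambda>i. Suc i mod n) ` {..<n} \<inter> A"
    by auto
  also have "\<dots> = A" unfolding eq using assms by auto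
  finally have 1: "card {i. i < n \<and> Suc i mod n \<in> A} = card A" .
  let ?both = "{i. i < n \<and> i \<in> A \<and> Suc i mod n \<in> A}"
  have "card A = card (?both \<union> {i. i < n \<and> i \<in> A \<and> Suc i mod n \<notin> A})"
    using assms by (intro arg_cong[where f = card]) auto
  also have "\<dots> = card ?both + cycle_cut n A"
    unfolding cycle_cut_def by (intro card_Un_disjoint) auto
  finally have 2: "card A = card ?both + cycle_cut n A" .
  have 3: "{i. i < n \<and> i \<in> {..<n} - A \<and> Suc i mod n \<notin> {..<n} - A}
      = {i. i < n \<and> i \<notin> A \<and> Suc i mod n \<in> A}"
    using False by auto
  have "card {i. i < n \<and> Suc i mod n \<in> A} = card (?both \<union> {i. i < n \<and> i \<notin> A \<and> Suc i mod n \<in> A})"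
    by (intro arg_cong[where f = card]) auto
  also have "\<dots> = card ?both + cycle_cut n ({..<n} - A)"
    unfolding cycle_cut_def 3 by (intro card_Un_disjoint) auto
  finally show ?thesis using 1 2 by simp
qed (simp add: cycle_cut_def)

lemma cycle_cut_submodular:
  "cycle_cut n (A \<union> B) + cycle_cut n (A \<inter> B) \<le> cycle_cut n A + cycle_cut n B"
proof -
  have *: "cycle_cut n X = (\<Sum>i<n. of_bool (i \<in> X \<and> Suc i mod n \<notin> X))" for X
    by (simp add: cycle_cut_def sum.If_cases of_bool_def Int_def)
  show ?thesis
    unfolding * sum.distrib[symmetric] by (rule sum_mono) auto
qed

lemma exit_exists:
  assumes "a mod n \<in> A" "(a + d) mod n \<notin> A"
  shows "\<exists>e<d. (a + e) mod n \<in> A \<and> Suc (a + e) mod n \<notin> A"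
  using assms(2)
proof (induction d)
  case (Suc d)
  then show ?case by (cases "(a + d) mod n \<in> A") (auto intro: less_SucI)
qed (use assms(1) in simp)

lemma cycle_cut_pos:
  assumes A: "A \<subseteq> {..<n}" "A \<noteq> {}" "A \<noteq> {..<n}" shows "1 \<le> cycle_cut n A"
proof -
  obtain a b where a: "a \<in> A" "a < n" and b: "b < n" "b \<notin> A" using A by blast
  have "a mod n \<in> A" "(a + (n - a + b)) mod n \<notin> A" using a b by simp_all
  then obtain e where e: "(a + e) mod n \<in> A" "Suc (a + e) mod n \<notin> A"
    using exit_exists by blast
  then have "(a + e) mod n \<in> {i. i < n \<and> i \<in> A \<and> Suc i mod n \<notin> A}"
    using a by (simp add: mod_Suc_eq)
  then have "cycle_cut n A \<noteq> 0" by (auto simp: cycle_cut_def)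
  then show ?thesis by simp
qed

lemma cycle_cut_arc:
  assumes l: "0 < l" "l < n" shows "cycle_cut n (arc n a l) = 1"
proof (rule antisym)
  have "i = (a + l - 1) mod n" if i: "i \<in> arc n a l" "Suc i mod n \<notin> arc n a l" for i
  proof -
    obtain j where j: "a \<le> j" "j < a + l" "i = j mod n" using i(1) by (auto simp: arc_def)
    have "Suc i mod n = Suc j mod n" using j(3) by (simp add: mod_Suc_eq)
    then have "\<not> Suc j < a + l" using i(2) j(1) by (auto simp: arc_def)
    then have "j = a + l - 1" using j by simp
    then show ?thesis using j by simp
  qed
  then have "{i. i < n \<and> i \<in> arc n a l \<and> Suc i mod n \<notin> arc n a l} \<subseteq> {(a + l - 1) mod n}"
    by blast
  then show "cycle_cut n (arc n a l) \<le> 1"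
    unfolding cycle_cut_def using card_mono[of "{(a + l - 1) mod n}"] by simp
  show "1 \<le> cycle_cut n (arc n a l)"
    using l by (intro cycle_cut_pos arc_subset arc_proper) simp_all
qed

lemma daisy_four_petals:
  assumes "0 < w" shows "four_petals w (cycle_cut (4 * w))"
proof
  show "cycle_cut (4 * w) {} = 0" by (simp add: cycle_cut_def)
qed (use assms cycle_cut_compl cycle_cut_submodular cycle_cut_pos cycle_cut_arc in auto)

text \<open>The set \<open>A\<close> consists of two disjoint intervals of \<open>w\<close> legs, opposite petals for \<open>u = 0\<close> and for
  \<open>u = w\<close>. The independent set takes one element of every leg of \<open>A\<close>, and a second one of the legs in \<open>F\<close>,
  the first interval together with one leg of the other. For a proper subset \<open>B\<close> of the legs the excess over
  \<open>B\<close> is at most \<open>w\<close>, unless \<open>F \<subseteq> B \<subseteq> A\<close>. But then \<open>B\<close> is left inside both intervals, so \<open>c B \<ge> 2\<close>, and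
  the allowance of \<open>2 * w\<close> covers the excess, which never exceeds \<open>card F = w + 1\<close>.\<close>

lemma (in four_petals) opposite_rank:
  assumes c: "c = cycle_cut (4 * w)" and u: "u \<le> w"
  shows "3 * w < rank cut_matroid (block 2 ({u..<u + w} \<union> {u + 2 * w..<u + 3 * w}))"
    (is "_ < rank _ (block 2 ?A)")
proof -
  let ?F = "insert (u + 2 * w) {u..<u + w}"
  have cF: "card ?F = w + 1" by simp
  have cA: "card ?A = 2 * w" by (subst card_Un_disjoint) auto
  have FA: "?F \<subseteq> ?A" using width_pos by auto
  have A: "?A \<subseteq> {..<4 * w}" using u by auto
  have "doubled ?A ?F \<in> indeps cut_matroid"
  proof (rule doubled_indep[OF A FA])
    fix B assume B: "B \<subseteq> {..<4 * w}"
    have finB: "finite B" using B finite_subset by blast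
    have AB: "card (?A \<inter> B) \<le> card B" using finB by (intro card_mono) auto
    have FB: "card (?F \<inter> B) \<le> w + 1" unfolding cF[symmetric] by (intro card_mono) auto
    show "card (?A \<inter> B) + card (?F \<inter> B) \<le> card B + w * c B"
    proof (cases "B = {} \<or> B = {..<4 * w}")
      case True
      have "card (?A \<inter> B) \<le> card ?A" by (intro card_mono) auto
      then have "card (?A \<inter> B) + card (?F \<inter> B) \<le> 4 * w"
        using cA FB width_pos by linarith
      then show ?thesis using True by auto
    next
      case False
      then have w1: "w \<le> w * c B" using cut_pos[OF B] by simp
      consider "\<not> ?F \<subseteq> B" | "\<not> B \<subseteq> ?A" | "?F \<subseteq> B" "B \<subseteq> ?A" by blast
      then show ?thesis
      proof cases
        case 1
        then have "?F \<inter> B \<subset> ?F" by blast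
        then have "card (?F \<inter> B) < w + 1" unfolding cF[symmetric] by (intro psubset_card_mono) auto
        then show ?thesis using AB w1 by linarith
      next
        case 2
        then have "?A \<inter> B \<subset> B" by blast
        then have "card (?A \<inter> B) < card B" by (intro psubset_card_mono finB)
        then show ?thesis using FB w1 by linarith
      next
        case 3
        have in1: "u mod (4 * w) \<in> B" "(u + 2 * w) mod (4 * w) \<in> B"
          using 3(1) u width_pos by auto
        have out1: "(u + w) mod (4 * w) \<notin> B" using 3(2) u width_pos by auto
        \<comment> \<open>For \<open>u = w\<close> the step leaving the second interval wraps around to \<open>0\<close>.\<close>
        have out2: "(u + 2 * w + w) mod (4 * w) \<notin> B"
        proof (cases "u = w")
          case True
          then show ?thesis using 3(2) width_pos by auto
        next
          case False
          then show ?thesis using 3(2) u width_pos by auto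
        qed
        let ?X = "{i. i < 4 * w \<and> i \<in> B \<and> Suc i mod (4 * w) \<notin> B}"
        obtain d where d: "d < w" "(u + d) mod (4 * w) \<in> B" "Suc (u + d) mod (4 * w) \<notin> B"
          using exit_exists[OF in1(1) out1] by blast
        obtain e where e: "e < w" "(u + 2 * w + e) mod (4 * w) \<in> B"
            "Suc (u + 2 * w + e) mod (4 * w) \<notin> B"
          using exit_exists[OF in1(2) out2] by blast
        have "{u + d, u + 2 * w + e} \<subseteq> ?X" using d e u by simp
        then have "card {u + d, u + 2 * w + e} \<le> card ?X" by (intro card_mono) auto
        moreover have "card {u + d, u + 2 * w + e} = 2" using d(1) by simp
        ultimately have "2 \<le> c B" by (simp add: c cycle_cut_def)
        then have "w * 2 \<le> w * c B" by (rule mult_le_mono2)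
        then show ?thesis using AB FB width_pos by linarith
      qed
    qed
  qed
  from indep_le_rank[OF this doubled_subset[OF FA]]
  show ?thesis using cF cA by (simp add: card_doubled)
qed

text \<open>The other non-empty proper subsets of a cycle of length four are the twelve arcs of lengths one to
  three.\<close>

lemma not_consecutive_four:
  assumes I: "I \<noteq> {}" "I \<subset> {..<4}" and n: "\<not> cyclically_consecutive 4 I"
  shows "I = {0, 2} \<or> I = {1, 3}"
proof -
  have ne: "I \<noteq> arc 4 a l" for a l
    using n by (auto simp: cyclically_consecutive_def arc_def)
  have arcs: "arc 4 a 1 = {a mod 4}" "arc 4 a 2 = {a mod 4, Suc a mod 4}"
    "arc 4 a 3 = {a mod 4, Suc a mod 4, Suc (Suc a) mod 4}" for a
    by (simp_all add: arc_def numeral_2_eq_2 numeral_3_eq_3 atLeastLessThanSuc insert_commute)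
  have arc_list: "arc 4 0 1 = {0}" "arc 4 1 1 = {1}" "arc 4 2 1 = {2}" "arc 4 3 1 = {3}"
    "arc 4 0 2 = {0, 1}" "arc 4 1 2 = {1, 2}" "arc 4 2 2 = {2, 3}" "arc 4 3 2 = {0, 3}"
    "arc 4 0 3 = {0, 1, 2}" "arc 4 1 3 = {1, 2, 3}" "arc 4 2 3 = {0, 2, 3}" "arc 4 3 3 = {0, 1, 3}"
    unfolding arcs by auto
  have "{..<4} = {0, 1, 2, 3 :: nat}" by auto
  then have "I \<in> Pow {0, 1, 2, 3}" "I \<noteq> {0, 1, 2, 3}" using I(2) by auto
  then show ?thesis
    using I(1) ne[of 0 1] ne[of 1 1] ne[of 2 1] ne[of 3 1] ne[of 0 2] ne[of 1 2] ne[of 2 2] ne[of 3 2]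
      ne[of 0 3] ne[of 1 3] ne[of 2 3] ne[of 3 3]
    unfolding arc_list Pow_insert Pow_empty image_Un image_insert image_empty
      Un_insert_left Un_empty_left insert_iff empty_iff
    by argo
qed

lemma (in four_petals) daisy_petals:
  assumes c: "c = cycle_cut (4 * w)"
  shows "daisy cut_matroid (2 * w + 1) petals"
  unfolding daisy_def length_petals
proof (intro conjI flower_petals allI impI iffI)
  fix I :: "nat set"
  assume "I \<noteq> {} \<and> I \<subset> {..<4}" and "cyclically_consecutive 4 I"
  then show "exactly_separating cut_matroid (2 * w + 1) (\<Union>j\<in>I. petals ! j)"
    by (intro exactly_separating_petals cut_consecutive) auto
next
  fix I :: "nat set"
  assume I: "I \<noteq> {} \<and> I \<subset> {..<4}"
    and sep: "exactly_separating cut_matroid (2 * w + 1) (\<Union>j\<in>I. petals ! j)"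
  define P Q where "P = {0..<0 + w} \<union> {0 + 2 * w..<0 + 3 * w}"
    and "Q = {w..<w + w} \<union> {w + 2 * w..<w + 3 * w}"
  show "cyclically_consecutive 4 I"
  proof (rule ccontr)
    assume "\<not> cyclically_consecutive 4 I"
    then have I2: "I = {0, 2} \<or> I = {1, 3}" using I by (intro not_consecutive_four) auto
    have blk: "block w {i} = {w * i..<w * i + w}" for i
      using width_pos by (auto simp: block_def div_nat_eqI dividend_less_times_div algebra_simps)
    have PQ: "block w {0, 2} = P" "block w {1, 3} = Q"
      using blk[of 0] blk[of 1] blk[of 2] blk[of 3] block_Un[of w "{0}" "{2}"] block_Un[of w "{1}" "{3}"]
      by (simp_all add: P_def Q_def insert_commute algebra_simps)
    have compl: "{..<4 * w} - P = Q" "{..<4 * w} - Q = P" and sub: "P \<subseteq> {..<4 * w}" "Q \<subseteq> {..<4 * w}"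
      by (auto simp: P_def Q_def)
    have "3 * w < rank cut_matroid (block 2 P)" "3 * w < rank cut_matroid (block 2 Q)"
      using opposite_rank[OF c, of 0] opposite_rank[OF c, of w] by (simp_all add: P_def Q_def)
    then have "2 * int w < connectivity cut_matroid (block 2 P)"
      "2 * int w < connectivity cut_matroid (block 2 Q)"
      using connectivity_block[OF sub(1)] connectivity_block[OF sub(2)] compl by simp_all
    then have "2 * int w < connectivity cut_matroid (block 2 (block w I))"
      using I2 PQ by (elim disjE) simp_all
    then show False
      using sep I petals_Union[of I] by (auto simp: exactly_separating_def)
  qed
qed

theorem mainTheorem4:
  fixes t :: nat
  assumes "even t" and "4 \<le> t"
  shows "(\<exists>(M :: nat matroid_structure) \<sigma> Ps.
            t_cyclic M t \<and> even_t_cyclic_ordering M t \<sigma> \<and>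
            even_concatenation (ground M) t \<sigma> Ps \<and> 4 \<le> length Ps \<and> anemone M (t - 1) Ps) \<and>
         (\<exists>(M :: nat matroid_structure) \<sigma> Ps.
            t_cyclic M t \<and> even_t_cyclic_ordering M t \<sigma> \<and>
            even_concatenation (ground M) t \<sigma> Ps \<and> 4 \<le> length Ps \<and> daisy M (t - 1) Ps)"
proof -
  define w where "w = t div 2 - 1"
  have w: "0 < w" and t: "t = 2 * w + 2" "t - 1 = 2 * w + 1"
    using assms by (auto simp: w_def elim!: evenE)
  define c where "c = (\<lambda>A :: nat set. if A = {} \<or> A = {..<4 * w} then 0 else 1 :: nat)"
  interpret A: four_petals w c unfolding c_def by (rule anemone_four_petals[OF w])
  interpret D: four_petals w "cycle_cut (4 * w)" by (rule daisy_four_petals[OF w])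
  have "anemone A.cut_matroid (2 * w + 1) A.petals"
    by (rule A.anemone_petals) (simp add: c_def)
  moreover have "daisy D.cut_matroid (2 * w + 1) D.petals"
    by (rule D.daisy_petals) simp
  ultimately show ?thesis
    unfolding t(2) unfolding t(1)
    using A.t_cyclic_cut_matroid A.even_t_cyclic_ordering_ordering A.even_concatenation_petals
      A.length_petals D.t_cyclic_cut_matroid D.even_t_cyclic_ordering_ordering
      D.even_concatenation_petals D.length_petals
    by (metis order_refl)
qed

end
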